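(* Let $n,p\ge 1$, and let $S\in\mathbb{R}^{n\times n}$ and $\Delta\in\mathbb{R}^{p\times p}$ be fixed symmetric positive definite matrices. Let $\mathbf{Y}=(Y_{s_1},\dots,Y_{s_n})^T$ be a random vector whose components take values in the sample space $\mathcal{S}_Y\subset\mathbb{R}$, let $y\mapsto\mu_y\in\mathbb{R}^p$ be a (measurable) function on $\mathcal{S}_Y$, and suppose that $\mu=E(\mu_{Y_{s_i}})$ for all $i=1,\dots,n$. Let $\mathbb{N}_Y\in\mathbb{R}^{n\times p}$ be the matrix whose $i$-th row is $\mu_{Y_{s_i}}^T$. Let $\mathbb{X}$ be a random $n\times p$ matrix such that $\mathbb{X}\mid\mathbf{Y}$ has log-likelihood (conditional log-density with respect to Lebesgue measure on $\mathbb{R}^{n\times p}$) $$ l(\mathbb{X}\mid\mathbf{Y};S,\Delta) = -\frac{np}{2}\log(2\pi)-\frac{p}{2}\log|S|-\frac{n}{2}\log|\Delta|-\frac12\,\mathrm{tr}\big((\mathbb{X}-\mathbb{N}_Y)\Delta^{-1}(\mathbb{X}-\mathbb{N}_Y)^T S^{-1}\big).$$ Let $A\in\mathbb{R}^{p\times d}$ be a matrix whose columns form a basis of $\mathrm{span}\{\mu_{y}-\mu : y\in\mathcal{S}_Y\}$. Then $$R(\mathbb{X})=\mathbb{X}\,\Delta^{-1}A$$ is a sufficient reduction for the regression of $\mathbf{Y}$ on $\mathbb{X}$.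
   Context: The rows of $\mathbb{X}$ are predictor vectors $\mathbf{X}_{s_i}^T$, with $\mathbf{X}_{s_i}\in\mathbb{R}^p$, observed at spatial locations $s_1,\dots,s_n$, and $Y_{s_i}\in\mathbb{R}$ is the response at location $s_i$. $|M|$ denotes the determinant of a square matrix $M$. The stated log-likelihood is that of the model $\mathbb{X}\mid\mathbf{Y}=\mathbb{N}_Y+\mathbb{E}$ with $\mathbb{E}$ independent of $\mathbf{Y}$ and $\mathrm{vec}(\mathbb{E}^T)\sim\mathcal{N}(0_{np},S\otimes\Delta)$. Definition: a (measurable) function $R(\mathbb{X})$ is a sufficient reduction for the regression of $\mathbf{Y}$ on $\mathbb{X}$ if the conditional distribution of $\mathbf{Y}$ given $\mathbb{X}$ equals the conditional distribution of $\mathbf{Y}$ given $R(\mathbb{X})$ (almost surely), i.e. $\mathbf{Y}$ and $\mathbb{X}$ are conditionally independent given $R(\mathbb{X})$. *)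

theory Defs
  imports "HOL-Probability.Probability"
begin

definition sym_pos_def :: "real ^ 'k ^ 'k \<Rightarrow> bool" where
  "sym_pos_def B \<longleftrightarrow> transpose B = B \<and> (\<forall>v. v \<noteq> 0 \<longrightarrow> v \<bullet> (B *v v) > 0)"

text \<open>The space is \<open>SY\<^sup>n\<close>, with the trace of the Borel sets; \<open>SY\<close> need not be Borel.\<close>

definition sample_algebra :: "real set \<Rightarrow> (real ^ 'n) measure" where
  "sample_algebra SY = restrict_space borel {y. \<forall>i. y $ i \<in> SY}"

definition mean_matrix :: "(real \<Rightarrow> real ^ 'p) \<Rightarrow> real ^ 'n \<Rightarrow> real ^ 'p ^ 'n" where
  "mean_matrix mu y = (\<chi> i. mu (y $ i))"

definition loglik ::
  "real ^ 'n ^ 'n \<Rightarrow> real ^ 'p ^ 'p \<Rightarrow> (real \<Rightarrow> real ^ 'p) \<Rightarrow> real ^ 'n \<Rightarrow> real ^ 'p ^ 'n \<Rightarrow> real" where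
  "loglik S \<Delta> mu y x =
     - (real CARD('n) * real CARD('p) / 2) * ln (2 * pi)
     - real CARD('p) / 2 * ln (det S)
     - real CARD('n) / 2 * ln (det \<Delta>)
     - 1 / 2 * trace ((x - mean_matrix mu y) ** matrix_inv \<Delta>
                       ** transpose (x - mean_matrix mu y) ** matrix_inv S)"

text \<open>The conditional density \<open>f y\<close> of \<open>X\<close> given \<open>Y = y\<close> with respect to \<open>N\<close>, expressed as
  the density of the joint law of \<open>(Y, X)\<close> with respect to (law of \<open>Y\<close>) \<open>\<Otimes>\<close> \<open>N\<close>.\<close>

definition has_cond_density ::
  "'w measure \<Rightarrow> 'b measure \<Rightarrow> ('w \<Rightarrow> 'b) \<Rightarrow> 'c measure \<Rightarrow> ('w \<Rightarrow> 'c) \<Rightarrow> ('b \<Rightarrow> 'c \<Rightarrow> real) \<Rightarrow> bool" where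
  "has_cond_density M MY Y N X f \<longleftrightarrow>
     distributed M (distr M MY Y \<Otimes>\<^sub>M N) (\<lambda>\<omega>. (Y \<omega>, X \<omega>)) (\<lambda>(y, x). ennreal (f y x))"

definition cond_prob_given ::
  "'w measure \<Rightarrow> 'c measure \<Rightarrow> ('w \<Rightarrow> 'c) \<Rightarrow> 'w set \<Rightarrow> 'w \<Rightarrow> real" where
  "cond_prob_given M MZ Z E = real_cond_exp M (vimage_algebra (space M) Z MZ) (indicator E)"

text \<open>The conditional distributions of \<open>Y\<close> given \<open>X\<close> and given \<open>R(X)\<close> are compared
  event by event, through versions of \<open>P(Y \<in> B | X)\<close> and \<open>P(Y \<in> B | R(X))\<close>; this avoids
  presupposing regular conditional distributions.\<close>

definition sufficient_reduction ::
  "'w measure \<Rightarrow> 'b measure \<Rightarrow> ('w \<Rightarrow> 'b) \<Rightarrow> 'c measure \<Rightarrow> ('w \<Rightarrow> 'c)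
     \<Rightarrow> 'r measure \<Rightarrow> ('c \<Rightarrow> 'r) \<Rightarrow> bool" where
  "sufficient_reduction M MY Y MX X MR R \<longleftrightarrow>
     Y \<in> M \<rightarrow>\<^sub>M MY \<and> X \<in> M \<rightarrow>\<^sub>M MX \<and> R \<in> MX \<rightarrow>\<^sub>M MR \<and>
     (\<forall>B\<in>sets MY. AE \<omega> in M.
        cond_prob_given M MX X (Y -` B \<inter> space M) \<omega>
      = cond_prob_given M MR (\<lambda>\<omega>. R (X \<omega>)) (Y -` B \<inter> space M) \<omega>)"

text \<open>Matrices with \<open>d\<close> columns are represented by their columns, indexed by \<open>{..<d}\<close>, because
  \<open>d = 0\<close> (constant \<open>\<mu>\<close>) has to be allowed and finite index types are nonempty. Only the values
  at indices below \<open>d\<close> matter.\<close>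

definition columns_basis :: "nat \<Rightarrow> (nat \<Rightarrow> 'v::real_vector) \<Rightarrow> 'v set \<Rightarrow> bool" where
  "columns_basis d A V \<longleftrightarrow>
     inj_on A {..<d} \<and> independent (A ` {..<d}) \<and> span (A ` {..<d}) = V"

definition mult_columns :: "nat \<Rightarrow> real ^ 'p ^ 'n \<Rightarrow> (nat \<Rightarrow> real ^ 'p) \<Rightarrow> nat \<Rightarrow> real ^ 'n" where
  "mult_columns d B A = (\<lambda>j\<in>{..<d}. B *v A j)"

abbreviation columns_borel :: "nat \<Rightarrow> (nat \<Rightarrow> real ^ 'n) measure" where
  "columns_borel d \<equiv> PiM {..<d} (\<lambda>_. borel)"

end

theory Submission
  imports Defs
begin

text \<open>By the Fisher--Neyman factorization: if the conditional density has the form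
  \<open>g y (R x) * h x\<close>, then \<open>h\<close> cancels in Bayes' formula, so \<open>P(Y \<in> B | X)\<close> and
  \<open>P(Y \<in> B | R(X))\<close> are the same quotient of integrals of \<open>g\<close> over the law of \<open>Y\<close>.
  For the normal density, expand the quadratic form in \<open>x - N\<^sub>y\<close> around the matrix \<open>N\<^sub>0\<close> with rows
  \<open>\<mu>\<close>: \<open>x\<close> and \<open>y\<close> interact only through the cross term \<open>tr(x \<Delta>\<^sup>-\<^sup>1 D\<^sup>T S\<^sup>-\<^sup>1)\<close> with \<open>D = N\<^sub>y - N\<^sub>0\<close>.
  The rows of \<open>D\<close> are combinations of the columns of \<open>A\<close>, so the cross term is a function
  of \<open>y\<close> and \<open>x \<Delta>\<^sup>-\<^sup>1 A\<close>.\<close>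

section \<open>Conditional probabilities and the factorization criterion\<close>

text \<open>The sets of the sigma-algebra generated by \<open>Z\<close> are exactly the preimages of
  sets \<open>C\<close> of \<open>MZ\<close>, so testing on them is the defining property of
  conditional expectation. Nonnegative integrals keep integrability out of the hypotheses.\<close>

lemma cond_prob_given_charact:
  assumes "prob_space M"
    and Z[measurable]: "Z \<in> M \<rightarrow>\<^sub>M MZ" and E[measurable]: "E \<in> sets M"
    and \<phi>[measurable]: "\<phi> \<in> borel_measurable MZ" and nonneg: "\<And>z. 0 \<le> \<phi> z"
    and eq: "\<And>C. C \<in> sets MZ \<Longrightarrow>
      (\<integral>\<^sup>+\<omega>. indicator E \<omega> * indicator C (Z \<omega>) \<partial>M) = (\<integral>\<^sup>+\<omega>. ennreal (\<phi> (Z \<omega>)) * indicator C (Z \<omega>) \<partial>M)"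
  shows "AE \<omega> in M. cond_prob_given M MZ Z E \<omega> = \<phi> (Z \<omega>)"
proof -
  interpret prob_space M by fact
  let ?F = "vimage_algebra (space M) Z MZ"
  have Zsp: "Z \<in> space M \<rightarrow> space MZ"
    using Z by (rule measurable_space[THEN funcsetI])
  have sub: "subalgebra M ?F"
    unfolding subalgebra_def using sets_image_in_sets[OF refl Z] by simp
  interpret finite_measure_subalgebra M ?F
    by unfold_locales (rule sub)
  show ?thesis
    unfolding cond_prob_given_def
  proof (rule real_cond_exp_charact)
    show "integrable M (indicator E :: _ \<Rightarrow> real)"
      by (simp add: integrable_indicator_iff emeasure_eq_measure)
    \<comment> \<open>The choice \<open>C = space MZ\<close> equates this integral with the
      probability of \<open>E\<close>, which yields integrability.\<close>
    have "(\<integral>\<^sup>+\<omega>. ennreal (\<phi> (Z \<omega>)) \<partial>M) = (\<integral>\<^sup>+\<omega>. ennreal (\<phi> (Z \<omega>)) * indicator (space MZ) (Z \<omega>) \<partial>M)"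
      using Zsp by (intro nn_integral_cong) (auto simp: indicator_def)
    also have "\<dots> = (\<integral>\<^sup>+\<omega>. indicator E \<omega> * indicator (space MZ) (Z \<omega>) \<partial>M)"
      by (simp add: eq)
    also have "\<dots> = (\<integral>\<^sup>+\<omega>. indicator E \<omega> \<partial>M)"
      using Zsp by (intro nn_integral_cong) (auto simp: indicator_def)
    also have "\<dots> < \<infinity>" by (simp add: emeasure_eq_measure)
    finally show int: "integrable M (\<lambda>\<omega>. \<phi> (Z \<omega>))"
      by (intro integrableI_nonneg) (auto simp: nonneg)
    show "(\<lambda>\<omega>. \<phi> (Z \<omega>)) \<in> borel_measurable ?F"
      using measurable_compose[OF measurable_vimage_algebra1[OF Zsp] \<phi>] .
    fix D assume "D \<in> sets ?F"
    then obtain C where [measurable]: "C \<in> sets MZ" and D: "D = Z -` C \<inter> space M"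
      by (auto simp: sets_vimage_algebra2[OF Zsp])
    have "(\<integral>\<omega>\<in>D. indicator E \<omega> \<partial>M) = (\<integral>\<omega>. indicator E \<omega> * (indicator C (Z \<omega>) :: real) \<partial>M)"
      unfolding set_lebesgue_integral_def D
      by (intro Bochner_Integration.integral_cong) (auto simp: indicator_def)
    also have "\<dots> = enn2real (\<integral>\<^sup>+\<omega>. indicator E \<omega> * indicator C (Z \<omega>) \<partial>M)"
      by (subst integral_eq_nn_integral) (auto simp: ennreal_mult ennreal_indicator)
    also have "\<dots> = enn2real (\<integral>\<^sup>+\<omega>. ennreal (\<phi> (Z \<omega>)) * indicator C (Z \<omega>) \<partial>M)"
      by (simp add: eq)
    also have "\<dots> = (\<integral>\<omega>. \<phi> (Z \<omega>) * indicator C (Z \<omega>) \<partial>M)"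
      by (subst integral_eq_nn_integral) (auto simp: ennreal_mult ennreal_indicator nonneg)
    also have "\<dots> = (\<integral>\<omega>\<in>D. \<phi> (Z \<omega>) \<partial>M)"
      unfolding set_lebesgue_integral_def D
      by (intro Bochner_Integration.integral_cong) (auto simp: indicator_def)
    finally show "(\<integral>\<omega>\<in>D. indicator E \<omega> \<partial>M) = (\<integral>\<omega>\<in>D. \<phi> (Z \<omega>) \<partial>M)" .
  qed
qed

text \<open>Both conditional probabilities are identified with one and the same function of
  \<open>R (X \<omega>)\<close>, a Bayes quotient in which \<open>h\<close> no longer
  occurs.\<close>

lemma factorization_imp_sufficient_reduction:
  fixes g :: "'b \<Rightarrow> 'r \<Rightarrow> ennreal" and h :: "'c \<Rightarrow> ennreal"
  assumes "prob_space M" and "sigma_finite_measure N"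
    and Y[measurable]: "Y \<in> M \<rightarrow>\<^sub>M MY" and X[measurable]: "X \<in> M \<rightarrow>\<^sub>M N"
    and R[measurable]: "R \<in> N \<rightarrow>\<^sub>M MR"
    and g[measurable]: "(\<lambda>(y, r). g y r) \<in> borel_measurable (MY \<Otimes>\<^sub>M MR)"
    and h[measurable]: "h \<in> borel_measurable N"
    and dens: "distributed M (distr M MY Y \<Otimes>\<^sub>M N) (\<lambda>\<omega>. (Y \<omega>, X \<omega>)) (\<lambda>(y, x). g y (R x) * h x)"
  shows "sufficient_reduction M MY Y N X MR R"
proof -
  interpret prob_space M by fact
  interpret N: sigma_finite_measure N by fact
  interpret PY: prob_space "distr M MY Y" by (rule prob_space_distr) fact
  interpret P: pair_sigma_finite "distr M MY Y" N ..
  \<comment> \<open>The unnormalised posterior integral of \<open>K\<close>; the constant 1 gives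
    the Bayes denominator.\<close>
  define m where "m K r = (\<integral>\<^sup>+y. g y r * K y \<partial>distr M MY Y)" for K r
  have m[measurable]: "m K \<in> borel_measurable MR" if [measurable]: "K \<in> borel_measurable MY" for K
    unfolding m_def by measurable
  \<comment> \<open>By Tonelli: the factors depending on \<open>x\<close> alone leave the inner
    integral over \<open>y\<close>.\<close>
  have joint: "(\<integral>\<^sup>+\<omega>. K (Y \<omega>) * k (X \<omega>) \<partial>M) = (\<integral>\<^sup>+x. h x * k x * m K (R x) \<partial>N)"
    if [measurable]: "K \<in> borel_measurable MY" "k \<in> borel_measurable N" for K k
  proof -
    have "(\<integral>\<^sup>+\<omega>. K (Y \<omega>) * k (X \<omega>) \<partial>M)
        = (\<integral>\<^sup>+z. (case z of (y, x) \<Rightarrow> g y (R x) * h x) * (case z of (y, x) \<Rightarrow> K y * k x) \<partial>(distr M MY Y \<Otimes>\<^sub>M N))"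
      by (subst distributed_nn_integral[OF dens]) auto
    also have "\<dots> = (\<integral>\<^sup>+x. \<integral>\<^sup>+y. (g y (R x) * h x) * (K y * k x) \<partial>distr M MY Y \<partial>N)"
      by (subst P.nn_integral_snd[symmetric]) auto
    also have "\<dots> = (\<integral>\<^sup>+x. h x * k x * m K (R x) \<partial>N)"
      unfolding m_def
      by (intro nn_integral_cong, subst nn_integral_cmult[symmetric]) (auto simp: mult_ac)
    finally show ?thesis .
  qed
  \<comment> \<open>The total mass is 1, so an infinite denominator forces \<open>h x = 0\<close>
    for almost every such \<open>x\<close>.\<close>
  have "(\<integral>\<^sup>+x. h x * m (\<lambda>_. 1) (R x) \<partial>N) = 1"
    using joint[OF borel_measurable_const[of 1] borel_measurable_const[of 1]]
    by (simp only: mult_1 mult_1_right nn_integral_const emeasure_space_1)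
  then have fin: "AE x in N. h x * m (\<lambda>_. 1) (R x) \<noteq> \<infinity>"
    by (intro nn_integral_noteq_infinite) auto
  have "AE \<omega> in M. cond_prob_given M N X (Y -` B \<inter> space M) \<omega>
      = cond_prob_given M MR (\<lambda>\<omega>. R (X \<omega>)) (Y -` B \<inter> space M) \<omega>" if B[measurable]: "B \<in> sets MY" for B
  proof -
    define \<phi> where "\<phi> r = enn2real (m (indicator B) r / m (\<lambda>_. 1) r)" for r
    have [measurable]: "\<phi> \<in> borel_measurable MR" unfolding \<phi>_def by measurable
    \<comment> \<open>The denominator can be \<open>0\<close> or \<open>\<infinity>\<close>; then the numerator, respectively \<open>h x\<close>, vanishes.\<close>
    have \<phi>m: "h x * m (indicator B) (R x) = h x * (ennreal (\<phi> (R x)) * m (\<lambda>_. 1) (R x))"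
      if "h x * m (\<lambda>_. 1) (R x) \<noteq> \<infinity>" for x
    proof -
      have le: "m (indicator B) (R x) \<le> m (\<lambda>_. 1) (R x)"
        unfolding m_def by (intro nn_integral_mono) (auto simp: indicator_def)
      consider "m (\<lambda>_. 1) (R x) = 0" | "m (\<lambda>_. 1) (R x) = top"
        | "m (\<lambda>_. 1) (R x) \<noteq> 0" "m (\<lambda>_. 1) (R x) \<noteq> top" by blast
      then show ?thesis
      proof cases
        case 1
        then show ?thesis using le by simp
      next
        case 2
        then show ?thesis using that by (auto simp: ennreal_mult_eq_top_iff)
      next
        case 3
        then have "m (indicator B) (R x) / m (\<lambda>_. 1) (R x) < top"
          using le by (auto simp: less_top[symmetric] ennreal_divide_eq_top_iff top_unique)
        then have "ennreal (\<phi> (R x)) = m (indicator B) (R x) / m (\<lambda>_. 1) (R x)"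
          unfolding \<phi>_def by simp
        then show ?thesis
          using 3 by (simp add: ennreal_divide_times ennreal_divide_self less_top[symmetric])
      qed
    qed
    have key: "(\<integral>\<^sup>+\<omega>. indicator (Y -` B \<inter> space M) \<omega> * indicator C (X \<omega>) \<partial>M)
        = (\<integral>\<^sup>+\<omega>. ennreal (\<phi> (R (X \<omega>))) * indicator C (X \<omega>) \<partial>M)" if [measurable]: "C \<in> sets N" for C
    proof -
      have "(\<integral>\<^sup>+\<omega>. indicator (Y -` B \<inter> space M) \<omega> * indicator C (X \<omega>) \<partial>M)
          = (\<integral>\<^sup>+\<omega>. indicator B (Y \<omega>) * indicator C (X \<omega>) \<partial>M)"
        by (intro nn_integral_cong) (auto simp: indicator_def)
      also have "\<dots> = (\<integral>\<^sup>+x. h x * indicator C x * m (indicator B) (R x) \<partial>N)"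
        by (rule joint) auto
      \<comment> \<open>The numerator is traded for \<phi> times the denominator, so that
        \<open>joint\<close> can be read backwards with \<open>K = 1\<close>.\<close>
      also have "\<dots> = (\<integral>\<^sup>+x. h x * (ennreal (\<phi> (R x)) * indicator C x) * m (\<lambda>_. 1) (R x) \<partial>N)"
      proof (rule nn_integral_cong_AE, use fin in eventually_elim)
        case (elim x)
        from \<phi>m[OF elim] show ?case
          by (cases "x \<in> C") (simp_all add: mult.assoc)
      qed
      also have "\<dots> = (\<integral>\<^sup>+\<omega>. ennreal (\<phi> (R (X \<omega>))) * indicator C (X \<omega>) \<partial>M)"
        by (subst joint[OF borel_measurable_const[of 1], symmetric]) simp_all
      finally show ?thesis .
    qed
    have [simp]: "0 \<le> \<phi> r" for r by (simp add: \<phi>_def)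
    have "AE \<omega> in M. cond_prob_given M N X (Y -` B \<inter> space M) \<omega> = \<phi> (R (X \<omega>))"
      by (rule cond_prob_given_charact) (use \<open>prob_space M\<close> key in auto)
    moreover have "AE \<omega> in M. cond_prob_given M MR (\<lambda>\<omega>. R (X \<omega>)) (Y -` B \<inter> space M) \<omega> = \<phi> (R (X \<omega>))"
    proof (rule cond_prob_given_charact)
      fix C assume [measurable]: "C \<in> sets MR"
      \<comment> \<open>A test set for \<open>R (X \<omega>)\<close> is a test set for
        \<open>X \<omega>\<close> after pulling back along \<open>R\<close>, so \<open>key\<close>
        covers this case too.\<close>
      have ind: "indicator (R -` C \<inter> space N) (X \<omega>) = (indicator C (R (X \<omega>)) :: ennreal)" if "\<omega> \<in> space M" for \<omega>
        using measurable_space[OF X that] by (auto simp: indicator_def)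
      show "(\<integral>\<^sup>+\<omega>. indicator (Y -` B \<inter> space M) \<omega> * indicator C (R (X \<omega>)) \<partial>M)
          = (\<integral>\<^sup>+\<omega>. ennreal (\<phi> (R (X \<omega>))) * indicator C (R (X \<omega>)) \<partial>M)"
        using key[of "R -` C \<inter> space N"] by (simp add: ind cong: nn_integral_cong_simp)
    qed (use \<open>prob_space M\<close> in auto)
    ultimately show ?thesis by eventually_elim simp
  qed
  then show ?thesis
    unfolding sufficient_reduction_def by auto
qed

section \<open>The trace form of the normal density\<close>

text \<open>Definiteness makes the kernel trivial, hence \<open>B\<close> invertible. Transposing
  the inverse gives a left inverse of the symmetric \<open>B\<close>, and this must equal the right
  inverse.\<close>

lemma sym_pos_def_matrix_inv_sym:
  assumes "sym_pos_def B"
  shows "transpose (matrix_inv B) = matrix_inv B"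
proof -
  have sym: "transpose B = B" using assms by (simp add: sym_pos_def_def)
  have "x = 0" if "B *v x = 0" for x
    using assms that unfolding sym_pos_def_def by (metis inner_zero_right less_irrefl)
  then have "invertible B"
    by (simp add: invertible_left_inverse matrix_left_invertible_ker)
  then have inv: "B ** matrix_inv B = mat 1" "matrix_inv B ** B = mat 1"
    using someI_ex[of "\<lambda>B'. B ** B' = mat 1 \<and> B' ** B = mat 1"]
    unfolding invertible_def matrix_inv_def by simp_all
  then have "transpose (matrix_inv B) ** B = mat 1"
    by (metis sym matrix_transpose_mul transpose_mat)
  then show ?thesis
    by (metis inv(1) matrix_mul_assoc matrix_mul_lid matrix_mul_rid)
qed

text \<open>With \<open>K\<close> and \<open>T\<close> the inverses of \<Delta> and
  \<open>S\<close>, this is the bilinear form whose diagonal is the quadratic form in the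
  log-likelihood.\<close>

definition trace_form ::
  "real ^ 'p ^ 'p \<Rightarrow> real ^ 'n ^ 'n \<Rightarrow> real ^ 'p ^ 'n \<Rightarrow> real ^ 'p ^ 'n \<Rightarrow> real" where
  "trace_form K T u v = trace (u ** K ** transpose v ** T)"

text \<open>This form isolates the rows of \<open>v\<close>, into which a basis expansion can be
  substituted, and makes linearity and measurability visible.\<close>

lemma trace_form_eq_sum:
  "trace_form K T u v = (\<Sum>k\<in>UNIV. \<Sum>i\<in>UNIV. ((u ** K) *v (v $ i)) $ k * T $ i $ k)"
  by (simp add: trace_form_def trace_def matrix_matrix_mult_def matrix_vector_mult_def transpose_def)

lemma trace_form_diff_left: "trace_form K T (u - v) w = trace_form K T u w - trace_form K T v w"
  by (simp add: trace_form_eq_sum matrix_matrix_mult_def matrix_vector_mult_def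
      sum_subtractf algebra_simps)

lemma trace_form_diff_right: "trace_form K T u (v - w) = trace_form K T u v - trace_form K T u w"
  by (simp add: trace_form_eq_sum matrix_vector_mult_diff_distrib sum_subtractf algebra_simps)

text \<open>The trace is invariant under transposition and under cyclic shifts.\<close>

lemma trace_form_commute:
  assumes "transpose K = K" "transpose T = T"
  shows "trace_form K T u v = trace_form K T v u"
proof -
  have "trace_form K T u v = trace (transpose (u ** K ** transpose v ** T))"
    by (simp add: trace_form_def trace_def transpose_def)
  also have "\<dots> = trace (T ** (v ** K ** transpose u))"
    by (simp add: matrix_transpose_mul assms matrix_mul_assoc)
  also have "\<dots> = trace_form K T v u"
    by (simp add: trace_form_def trace_mul_sym[of T])
  finally show ?thesis .
qed

lemma borel_measurable_trace_form:
  assumes "\<And>i j. (\<lambda>w. u w $ i $ j) \<in> borel_measurable L"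
    and "\<And>i j. (\<lambda>w. v w $ i $ j) \<in> borel_measurable L"
  shows "(\<lambda>w. trace_form K T (u w) (v w)) \<in> borel_measurable L"
  unfolding trace_form_eq_sum matrix_matrix_mult_def matrix_vector_mult_def
  using assms by simp

section \<open>Coordinates with respect to the columns of \<open>A\<close>\<close>

text \<open>The dual basis, extended linearly to the whole space. On a Euclidean space such
  functionals are continuous, so coefficients obtained from them depend measurably on their
  argument.\<close>

lemma coordinate_functionals:
  fixes A :: "nat \<Rightarrow> 'v::real_vector"
  assumes "columns_basis d A V"
  obtains \<phi> :: "nat \<Rightarrow> 'v \<Rightarrow> real"
  where "\<And>j. linear (\<phi> j)" "\<And>v. v \<in> V \<Longrightarrow> v = (\<Sum>j<d. \<phi> j v *\<^sub>R A j)"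
proof -
  have inj: "inj_on A {..<d}" and ind: "independent (A ` {..<d})" and V: "V = span (A ` {..<d})"
    using assms by (auto simp: columns_basis_def)
  have "\<exists>f. linear f \<and> (\<forall>a\<in>A ` {..<d}. f a = (if a = A j then 1 else 0 :: real))" for j
    using linear_independent_extend[OF ind] .
  then obtain \<phi> :: "nat \<Rightarrow> 'v \<Rightarrow> real" where lin: "\<And>j. linear (\<phi> j)"
    and \<phi>: "\<And>j a. a \<in> A ` {..<d} \<Longrightarrow> \<phi> j a = (if a = A j then 1 else 0)"
    by metis
  have "v = (\<Sum>j<d. \<phi> j v *\<^sub>R A j)" if "v \<in> V" for v
  proof (rule linear_eq_on_span[where f = "\<lambda>v. v" and B = "A ` {..<d}"])
    show "linear (\<lambda>v. \<Sum>j<d. \<phi> j v *\<^sub>R A j)"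
      by (rule linearI)
         (simp_all add: linear_add[OF lin] linear_scale[OF lin] scaleR_add_left sum.distrib scaleR_sum_right)
    fix a assume "a \<in> A ` {..<d}"
    then obtain i where i: "i < d" "a = A i" by auto
    \<comment> \<open>Injectivity of \<open>A\<close> on the indices leaves a single nonzero
      summand.\<close>
    have "(\<Sum>j<d. \<phi> j a *\<^sub>R A j) = (\<Sum>j<d. if j = i then A j else 0)"
      using i inj by (intro sum.cong) (auto simp: \<phi> inj_on_def)
    then show "a = (\<Sum>j<d. \<phi> j a *\<^sub>R A j)" using i by simp
  qed (use that V linear_id in \<open>auto simp: id_def\<close>)
  with lin show ?thesis by (rule that)
qed

lemma borel_measurable_mult_columns:
  "(\<lambda>x. mult_columns d (x ** K) A) \<in> borel \<rightarrow>\<^sub>M columns_borel d"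
proof -
  have "(\<lambda>x. (x ** K) *v A j) \<in> borel_measurable borel" for j
  proof -
    have "linear (\<lambda>x. (x ** K) *v A j)"
      by (rule linearI) (simp_all add: vec_eq_iff matrix_matrix_mult_def matrix_vector_mult_def
          sum.distrib sum_distrib_left algebra_simps)
    then show ?thesis
      by (intro borel_measurable_continuous_onI linear_continuous_on)
         (simp add: linear_conv_bounded_linear)
  qed
  then show ?thesis
    unfolding mult_columns_def by (intro measurable_restrict)
qed

text \<open>If the rows of \<open>v\<close> are combinations of the \<open>A j\<close>, then
  \<open>u\<close> enters only through the products of \<open>u ** K\<close> with the
  \<open>A j\<close>, that is, through the reduction.\<close>

lemma trace_form_coordinates:
  assumes "\<And>i. v $ i = (\<Sum>j<d. c i j *\<^sub>R A j)"
  shows "trace_form K T u v =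
    (\<Sum>k\<in>UNIV. \<Sum>i\<in>UNIV. (\<Sum>j<d. c i j * mult_columns d (u ** K) A j $ k) * T $ i $ k)"
proof -
  have "((u ** K) *v (v $ i)) $ k = (\<Sum>j<d. c i j * mult_columns d (u ** K) A j $ k)" for i k
    by (simp add: assms mult_columns_def vec.sum matrix_vector_mult_scaleR)
  then show ?thesis by (simp add: trace_form_eq_sum)
qed

section \<open>Sufficiency in the normal model\<close>

theorem theorem2p1:
  fixes M :: "'w measure"
    and S :: "real ^ 'n ^ 'n" and \<Delta> :: "real ^ 'p ^ 'p"
    and SY :: "real set"
    and Y :: "'w \<Rightarrow> real ^ 'n" and X :: "'w \<Rightarrow> real ^ 'p ^ 'n"
    and mu :: "real \<Rightarrow> real ^ 'p" and mu0 :: "real ^ 'p"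
    and d :: nat and A :: "nat \<Rightarrow> real ^ 'p"
  assumes "prob_space M"
    and "sym_pos_def S" and "sym_pos_def \<Delta>"
    and "Y \<in> M \<rightarrow>\<^sub>M sample_algebra SY"
    and "X \<in> M \<rightarrow>\<^sub>M borel"
    and "mu \<in> restrict_space borel SY \<rightarrow>\<^sub>M borel"
    and "\<And>i. has_bochner_integral M (\<lambda>\<omega>. mu (Y \<omega> $ i)) mu0"
    and "has_cond_density M (sample_algebra SY) Y lborel X (\<lambda>y x. exp (loglik S \<Delta> mu y x))"
    and "columns_basis d A (span {mu y - mu0 | y. y \<in> SY})"
  shows "sufficient_reduction M (sample_algebra SY) Y borel X (columns_borel d)
           (\<lambda>x. mult_columns d (x ** matrix_inv \<Delta>) A)"
proof -
  define K T where "K = matrix_inv \<Delta>" and "T = matrix_inv S"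
  have sym: "transpose K = K" "transpose T = T"
    using assms(2,3) by (simp_all add: K_def T_def sym_pos_def_matrix_inv_sym)
  obtain \<phi> where lin: "\<And>j. linear (\<phi> j)"
    and \<phi>: "\<And>v. v \<in> span {mu y - mu0 | y. y \<in> SY} \<Longrightarrow> v = (\<Sum>j<d. \<phi> j v *\<^sub>R A j)"
    by (rule coordinate_functionals[OF assms(9)], rule that)
  define N0 :: "real ^ 'p ^ 'n" where "N0 = (\<chi> i. mu0)"
  define D where "D y = mean_matrix mu y - N0" for y :: "real ^ 'n"
  define c where "c = - (real CARD('n) * real CARD('p) / 2) * ln (2 * pi)
     - real CARD('p) / 2 * ln (det S) - real CARD('n) / 2 * ln (det \<Delta>)"
  \<comment> \<open>Expanding around \<open>N0\<close>, \<open>h\<close> collects the constant and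
    the terms in \<open>x\<close> alone; \<open>g\<close> takes the terms in \<open>y\<close> alone
    and the cross term, with \<open>r\<close> in place of the reduction.\<close>
  define h where "h x = exp (c - 1 / 2 * trace_form K T (x - N0) (x - N0))" for x
  define g where "g y r = exp ((\<Sum>k\<in>UNIV. \<Sum>i\<in>UNIV. (\<Sum>j<d. \<phi> j (D y $ i) * r j $ k) * T $ i $ k)
     - trace_form K T N0 (D y) - 1 / 2 * trace_form K T (D y) (D y))"
    for y and r :: "nat \<Rightarrow> real ^ 'n"
  let ?R = "\<lambda>x. mult_columns d (x ** K) A"

  \<comment> \<open>Restricted to the sample space, because only there are the rows of
    \<open>D y\<close> known to lie in the span.\<close>
  have factor: "exp (loglik S \<Delta> mu y x) = g y (?R x) * h x"
    if "y \<in> space (sample_algebra SY)" for y x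
  proof -
    have SY: "y $ i \<in> SY" for i
      using that by (simp add: sample_algebra_def space_restrict_space)
    have "D y $ i = (\<Sum>j<d. \<phi> j (D y $ i) *\<^sub>R A j)" for i
      by (rule \<phi>, rule span_base) (use SY in \<open>auto simp: D_def N0_def mean_matrix_def\<close>)
    then have "trace_form K T x (D y) =
        (\<Sum>k\<in>UNIV. \<Sum>i\<in>UNIV. (\<Sum>j<d. \<phi> j (D y $ i) * ?R x j $ k) * T $ i $ k)"
      by (rule trace_form_coordinates)
    moreover have "loglik S \<Delta> mu y x = c - 1 / 2 * trace_form K T ((x - N0) - D y) ((x - N0) - D y)"
      by (simp add: loglik_def c_def trace_form_def K_def T_def D_def)
    moreover have "\<dots> = c - 1 / 2 * trace_form K T (x - N0) (x - N0) + trace_form K T x (D y)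
        - trace_form K T N0 (D y) - 1 / 2 * trace_form K T (D y) (D y)"
      using trace_form_commute[OF sym, of "D y" x] trace_form_commute[OF sym, of "D y" N0]
      unfolding trace_form_diff_left trace_form_diff_right by (simp add: field_simps)
    ultimately show ?thesis
      by (simp add: g_def h_def flip: exp_add)
  qed

  have nth[measurable]: "(\<lambda>x::real ^ 'p ^ 'n. x $ i $ j) \<in> borel_measurable borel" for i j
    by (intro borel_measurable_continuous_onI continuous_intros)
  have Dm[measurable]: "(\<lambda>y. D y $ i) \<in> borel_measurable (sample_algebra SY)" for i
  proof -
    \<comment> \<open>\<open>mu\<close> is measurable only on \<open>SY\<close> with its trace
      algebra, so the coordinate map must land there.\<close>
    have "(\<lambda>y. y $ i) \<in> sample_algebra SY \<rightarrow>\<^sub>M restrict_space borel SY"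
      unfolding sample_algebra_def
      by (rule measurable_restrict_space3) (auto intro!: borel_measurable_continuous_onI continuous_intros)
    from measurable_compose[OF this assms(6)] show ?thesis
      by (simp add: D_def N0_def mean_matrix_def)
  qed
  have [measurable]: "\<phi> j \<in> borel_measurable borel" for j
    by (intro borel_measurable_continuous_onI linear_continuous_on)
       (simp add: lin linear_linear)
  have [measurable]: "(\<lambda>x. trace_form K T (x - N0) (x - N0)) \<in> borel_measurable borel"
    by (rule borel_measurable_trace_form) simp_all
  have [measurable]: "h \<in> borel_measurable borel"
    unfolding h_def by measurable
  have [measurable]: "(\<lambda>y. trace_form K T N0 (D y)) \<in> borel_measurable (sample_algebra SY)"
    "(\<lambda>y. trace_form K T (D y) (D y)) \<in> borel_measurable (sample_algebra SY)"
    by (auto intro!: borel_measurable_trace_form measurable_compose[OF Dm])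
  have [measurable]: "(\<lambda>z. snd z j $ k) \<in> borel_measurable (sample_algebra SY \<Otimes>\<^sub>M columns_borel d)"
    if "j \<in> {..<d}" for j k
  proof -
    have "(\<lambda>z. snd z j) \<in> sample_algebra SY \<Otimes>\<^sub>M columns_borel d \<rightarrow>\<^sub>M borel"
      using that by (intro measurable_compose[OF measurable_snd] measurable_component_singleton)
    then show ?thesis
      by (rule measurable_compose) (intro borel_measurable_continuous_onI continuous_intros)
  qed
  have gm: "(\<lambda>(y, r). g y r) \<in> borel_measurable (sample_algebra SY \<Otimes>\<^sub>M columns_borel d)"
    unfolding g_def by measurable

  have "sufficient_reduction M (sample_algebra SY) Y lborel X (columns_borel d) ?R"
  proof (rule factorization_imp_sufficient_reduction)
    show "distributed M (distr M (sample_algebra SY) Y \<Otimes>\<^sub>M lborel) (\<lambda>\<omega>. (Y \<omega>, X \<omega>))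
        (\<lambda>(y, x). ennreal (g y (?R x)) * ennreal (h x))"
    proof (rule distributed_cong_density[THEN iffD1])
      show "AE z in distr M (sample_algebra SY) Y \<Otimes>\<^sub>M lborel.
          (case z of (y, x) \<Rightarrow> ennreal (exp (loglik S \<Delta> mu y x)))
        = (case z of (y, x) \<Rightarrow> ennreal (g y (?R x)) * ennreal (h x))"
        \<comment> \<open>Every \<open>y\<close> in the underlying product space lies in the sample
          space, so \<open>factor\<close> applies at every point.\<close>
        by (rule AE_I2) (auto simp: space_pair_measure factor g_def h_def simp flip: ennreal_mult)
      show dens: "distributed M (distr M (sample_algebra SY) Y \<Otimes>\<^sub>M lborel) (\<lambda>\<omega>. (Y \<omega>, X \<omega>))
          (\<lambda>(y, x). ennreal (exp (loglik S \<Delta> mu y x)))"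
        using assms(8) by (simp add: has_cond_density_def)
      then show "(\<lambda>(y, x). ennreal (exp (loglik S \<Delta> mu y x)))
          \<in> borel_measurable (distr M (sample_algebra SY) Y \<Otimes>\<^sub>M lborel)"
        by (rule distributed_borel_measurable)
      show "(\<lambda>(y, x). ennreal (g y (?R x)) * ennreal (h x))
          \<in> borel_measurable (distr M (sample_algebra SY) Y \<Otimes>\<^sub>M lborel)"
      proof -
        have [measurable]: "(\<lambda>z. ?R (snd z)) \<in> sample_algebra SY \<Otimes>\<^sub>M borel \<rightarrow>\<^sub>M columns_borel d"
          by (rule measurable_compose[OF measurable_snd borel_measurable_mult_columns])
        show ?thesis using gm by measurable
      qed
    qed
  qed (use assms gm in \<open>auto simp: lborel.sigma_finite_measure_axioms borel_measurable_mult_columns\<close>)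
  \<comment> \<open>\<open>lborel\<close> served as reference measure; it has the same sets as
    \<open>borel\<close>, so \<open>X\<close> generates the same sigma-algebra.\<close>
  moreover have "vimage_algebra (space M) X lborel = vimage_algebra (space M) X borel"
    by (rule vimage_algebra_cong) simp_all
  ultimately show ?thesis
    by (simp add: sufficient_reduction_def cond_prob_given_def K_def)
qed
end
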